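(* Let $f=h+\overline{g}\in\mathcal{H}$ be a fully convex harmonic mapping, where $h$ and $g$ are analytic in $\mathbb{D}$. Then for all $r\in(0,1)$ and all $z_1,z_2\in\mathbb{D}_r$, $$\frac{|f(z_2)-f(z_1)|}{1+r}\le|h(z_2)-h(z_1)|\le\frac{|f(z_2)-f(z_1)|}{1-r}.$$
   Context: $\mathbb{D}$ is the open unit disk in $\mathbb{C}$ and $\mathbb{D}_r=\{z:|z|<r\}$. $\mathcal{H}$ denotes the set of all sense-preserving harmonic mappings $f=h+\overline{g}$ in $\mathbb{D}$ ($h,g$ analytic in $\mathbb{D}$) with $h(0)=g(0)=f_{\overline z}(0)=0$, i.e. $h(0)=g(0)=g'(0)=0$; "sense-preserving" means (locally univalent and) $|g'(z)|<|h'(z)|$ for all $z\in\mathbb{D}$. A sense-preserving and univalent (injective) harmonic mapping $f$ in $\mathbb{D}$ is called fully convex if it maps every circle $|z|=r<1$ onto a convex curve (i.e. a simple closed curve bounding a convex domain). *)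

theory Defs
  imports "HOL-Complex_Analysis.Complex_Analysis"
begin

text \<open>
  The predicates on harmonic mappings carry the holomorphic part \<open>h\<close> and the co-holomorphic
  part \<open>g\<close> of \<open>f = h + cnj g\<close> explicitly, since these are determined by \<open>f\<close> only up to an
  additive constant. Values of the functions outside the open unit disk are irrelevant.
\<close>

definition harmonic_mapping ::
  "(complex \<Rightarrow> complex) \<Rightarrow> (complex \<Rightarrow> complex) \<Rightarrow> (complex \<Rightarrow> complex) \<Rightarrow> bool" where
  "harmonic_mapping f h g \<longleftrightarrow>
     h holomorphic_on ball 0 1 \<and> g holomorphic_on ball 0 1 \<and>
     (\<forall>z\<in>ball 0 1. f z = h z + cnj (g z))"

definition locally_univalent :: "(complex \<Rightarrow> complex) \<Rightarrow> bool" where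
  "locally_univalent f \<longleftrightarrow>
     (\<forall>z\<in>ball 0 1. \<exists>U. open U \<and> z \<in> U \<and> U \<subseteq> ball 0 1 \<and> inj_on f U)"

definition sense_preserving ::
  "(complex \<Rightarrow> complex) \<Rightarrow> (complex \<Rightarrow> complex) \<Rightarrow> (complex \<Rightarrow> complex) \<Rightarrow> bool" where
  "sense_preserving f h g \<longleftrightarrow>
     harmonic_mapping f h g \<and> locally_univalent f \<and>
     (\<forall>z\<in>ball 0 1. norm (deriv g z) < norm (deriv h z))"

text \<open>
  The condition \<open>deriv g 0 = 0\<close> is the vanishing at \<open>0\<close> of the derivative of \<open>f\<close> with respect
  to the conjugate variable, which equals \<open>cnj (deriv g z)\<close>.
\<close>

definition normalized_harmonic ::
  "(complex \<Rightarrow> complex) \<Rightarrow> (complex \<Rightarrow> complex) \<Rightarrow> (complex \<Rightarrow> complex) \<Rightarrow> bool" where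
  "normalized_harmonic f h g \<longleftrightarrow>
     sense_preserving f h g \<and> h 0 = 0 \<and> g 0 = 0 \<and> deriv g 0 = 0"

text \<open>By the Jordan curve theorem, \<open>inside C\<close> is the domain bounded by the simple closed curve \<open>C\<close>.\<close>

definition convex_curve :: "complex set \<Rightarrow> bool" where
  "convex_curve C \<longleftrightarrow>
     (\<exists>\<gamma>. simple_path \<gamma> \<and> pathfinish \<gamma> = pathstart \<gamma> \<and> path_image \<gamma> = C) \<and>
     convex (inside C)"

definition fully_convex ::
  "(complex \<Rightarrow> complex) \<Rightarrow> (complex \<Rightarrow> complex) \<Rightarrow> (complex \<Rightarrow> complex) \<Rightarrow> bool" where
  "fully_convex f h g \<longleftrightarrow>
     sense_preserving f h g \<and> inj_on f (ball 0 1) \<and>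
     (\<forall>r. 0 < r \<and> r < 1 \<longrightarrow> convex_curve (f ` sphere 0 r))"

end

theory Submission
  imports Defs
begin

text \<open>
  For \<open>a + cnj b = c\<close> one has \<open>norm a ^ 2 - norm b ^ 2 = Re ((a - cnj b) * cnj c)\<close>. Since \<open>f\<close> maps
  disks onto convex sets, the preimage under \<open>f\<close> of the segment from \<open>f z1\<close> to \<open>f z2\<close> is a smooth
  curve in the disk; along it the identity, applied to the derivatives, shows that
  \<open>Re ((h - cnj g) * cnj (f z2 - f z1))\<close> strictly increases, and the identity applied to the
  increments gives \<open>norm (g z2 - g z1) < norm (h z2 - h z1)\<close>. Schwarz' lemma for the quotient
  \<open>(g (t * z2) - g (t * z1)) / (h (t * z2) - h (t * z1))\<close>, as a function of \<open>t\<close>, improves this to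
  \<open>norm (g z2 - g z1) \<le> r * norm (h z2 - h z1)\<close> when \<open>z1\<close> and \<open>z2\<close> lie in the disk of
  radius \<open>r\<close>.
\<close>

text \<open>By invariance of domain the image of the open disk is open, and its union with the curve
  is compact. So it is both open and closed relative to the complement of the curve, and bounded.
  This puts it inside the curve, and it fills the inside because a convex set is connected.\<close>

lemma convex_image_ball_if_convex_inside:
  fixes f :: "complex \<Rightarrow> complex"
  assumes "0 < r" and cont: "continuous_on (cball 0 r) f" and inj: "inj_on f (cball 0 r)"
    and conv: "convex (inside (f ` sphere 0 r))"
  shows "convex (f ` ball 0 r)"
proof -
  let ?C = "f ` sphere 0 r" and ?U = "f ` ball 0 r"
  have split: "f ` cball 0 r = ?U \<union> ?C"
    unfolding image_Un [symmetric] by (rule arg_cong [of _ _ "image f"]) auto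
  have disj: "?U \<inter> ?C = {}"
    using inj by (force simp: inj_on_def)
  have opn: "open ?U"
    using invariance_of_domain [OF continuous_on_subset [OF cont ball_subset_cball] open_ball]
      inj_on_subset [OF inj ball_subset_cball] by blast
  have cpt: "compact (f ` cball 0 r)"
    using cont by (intro compact_continuous_image) auto
  have "connected ?U"
    using continuous_on_subset [OF cont ball_subset_cball]
    by (intro connected_continuous_image) auto
  have U_ne: "?U \<noteq> {}"
    using \<open>0 < r\<close> by simp
  have Usub: "?U \<subseteq> inside ?C"
  proof
    fix w assume w: "w \<in> ?U"
    let ?K = "connected_component_set (- ?C) w"
    have K: "?K \<subseteq> - ?C"
      by (rule connected_component_subset)
    have "?K \<subseteq> ?U"
    proof (rule ccontr)
      assume "\<not> ?K \<subseteq> ?U"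
      then have "- f ` cball 0 r \<inter> ?K \<noteq> {}"
        using K split by blast
      moreover have "?U \<inter> ?K \<noteq> {}"
        using w disj connected_component_refl [of w "- ?C"] by blast
      moreover have "open (- f ` cball 0 r)"
        using cpt compact_imp_closed by blast
      ultimately show False
        using connectedD [OF connected_connected_component opn, of "- f ` cball 0 r" "- ?C" w]
          K split by blast
    qed
    moreover have "bounded ?U"
      using cpt split by (metis bounded_Un compact_imp_bounded)
    ultimately have "bounded ?K"
      using bounded_subset by blast
    then show "w \<in> inside ?C"
      using w disj by (auto simp: inside_def)
  qed
  have "inside ?C \<subseteq> ?U"
  proof (rule ccontr)
    assume "\<not> inside ?C \<subseteq> ?U"
    then have "- f ` cball 0 r \<inter> inside ?C \<noteq> {}"
      using split inside_no_overlap [of ?C] by blast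
    moreover have "?U \<inter> inside ?C \<noteq> {}"
      using Usub U_ne by blast
    moreover have "open (- f ` cball 0 r)"
      using cpt compact_imp_closed by blast
    ultimately show False
      using connectedD [OF convex_connected [OF conv] opn, of "- f ` cball 0 r"]
        split inside_no_overlap [of ?C] by blast
  qed
  with Usub conv show ?thesis
    by (metis subset_antisym)
qed

lemma norm_diff_eq_Re:
  fixes a b c :: complex
  assumes "a + cnj b = c"
  shows "(norm a)\<^sup>2 - (norm b)\<^sup>2 = Re ((a - cnj b) * cnj c)"
  unfolding assms [symmetric] cmod_power2 by (simp add: algebra_simps power2_eq_square)

lemma norm_diff_co_holomorphic_less:
  fixes f h g :: "complex \<Rightarrow> complex"
  assumes S: "open S" and h: "h holomorphic_on S" and g: "g holomorphic_on S"
    and f: "\<And>z. z \<in> S \<Longrightarrow> f z = h z + cnj (g z)" and inj: "inj_on f S"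
    and dil: "\<And>z. z \<in> S \<Longrightarrow> norm (deriv g z) < norm (deriv h z)"
    and z: "z1 \<in> S" "z2 \<in> S" "z1 \<noteq> z2"
    and seg: "closed_segment (f z1) (f z2) \<subseteq> f ` S"
  shows "norm (g z2 - g z1) < norm (h z2 - h z1)"
proof -
  define c where "c = f z2 - f z1"
  define p where "p = inv_into S f"
  define w where "w = (\<lambda>s::real. f z1 + of_real s * c)"
  \<comment> \<open>Up to the factor \<open>norm c\<close>, this is the component of
    \<open>h - cnj g\<close> in the direction \<open>c\<close> along the preimage of the segment.
    Its increment from 0 to 1 is
    \<open>norm (h z2 - h z1) ^ 2 - norm (g z2 - g z1) ^ 2\<close>.\<close>
  define \<phi> where "\<phi> = (\<lambda>s. Re ((h (p (w s)) - cnj (g (p (w s)))) * cnj c))"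
  have c: "c \<noteq> 0"
    using inj z by (auto simp: c_def inj_on_def)
  have pf: "p (f x) = x" if "x \<in> S" for x
    using that inj by (simp add: p_def)
  have "continuous_on S (\<lambda>z. h z + cnj (g z))"
    by (intro continuous_intros holomorphic_on_imp_continuous_on h g)
  then have cont: "continuous_on S f"
    using f by (simp cong: continuous_on_cong_simp)
  have "\<exists>y. (\<phi> has_real_derivative y) (at s) \<and> 0 < y" if s: "0 \<le> s" "s \<le> 1" for s
  proof -
    have "w s = (1 - s) *\<^sub>R f z1 + s *\<^sub>R f z2"
      by (simp add: w_def c_def algebra_simps scaleR_conv_of_real)
    then have "w s \<in> f ` S"
      using seg s by (auto simp: closed_segment_def)
    then obtain x where x: "x \<in> S" "f x = w s"
      by auto
    define a b where "a = deriv h x" and "b = deriv g x"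
    have dh: "(h has_field_derivative a) (at x)" and dg: "(g has_field_derivative b) (at x)"
      using h g S x by (auto simp: a_def b_def holomorphic_derivI)
    have ba: "norm b < norm a"
      using dil x by (simp add: a_def b_def)
    \<comment> \<open>\<open>J\<close> is the Jacobian of \<open>f\<close> at \<open>x\<close>, kept
      as a complex number; it is real and positive.\<close>
    define J where "J = a * cnj a - b * cnj b"
    have J: "J \<noteq> 0" "cnj J = J"
    proof -
      have "(norm b)\<^sup>2 < (norm a)\<^sup>2"
        using ba by (simp add: power_strict_mono)
      moreover have "J = of_real ((norm a)\<^sup>2 - (norm b)\<^sup>2)"
        by (simp only: J_def complex_norm_square of_real_diff)
      ultimately show "J \<noteq> 0"
        by (metis diff_gt_0_iff_gt less_irrefl of_real_eq_0_iff)
    qed (simp add: J_def)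
    \<comment> \<open>The inverse of the differential
      \<open>v \<mapsto> a * v + cnj (b * v)\<close>: eliminate \<open>cnj v\<close> from the
      equation for \<open>u\<close> and its conjugate.\<close>
    define q where "q = (\<lambda>u. (cnj a * u - cnj b * cnj u) / J)"
    have inv: "a * q u + cnj (b * q u) = u" for u
    proof -
      have "a * q u + cnj (b * q u) =
          (a * (cnj a * u - cnj b * cnj u) + cnj b * (a * cnj u - b * u)) / J"
        by (simp add: q_def J add_divide_distrib)
      also have "a * (cnj a * u - cnj b * cnj u) + cnj b * (a * cnj u - b * u) = J * u"
        by (simp add: J_def algebra_simps)
      finally show ?thesis
        using J by simp
    qed
    have "((\<lambda>z. h z + cnj (g z)) has_derivative (\<lambda>v. a * v + cnj (b * v))) (at x)"
      using dh dg unfolding has_field_derivative_def by (intro has_derivative_add has_derivative_cnj)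
    then have df: "(f has_derivative (\<lambda>v. a * v + cnj (b * v))) (at x)"
      by (rule has_derivative_transform_within_open [OF _ S x(1)]) (simp add: f)
    have "(p has_derivative q) (at (w s))"
      using has_derivative_inverse_strong [OF S x(1) cont _ df, of p q] pf inv x
      by (auto simp: fun_eq_iff)
    moreover have "(w has_vector_derivative c) (at s)"
      unfolding w_def by (auto intro!: derivative_eq_intros)
    ultimately have dp: "((\<lambda>s. p (w s)) has_vector_derivative q c) (at s)"
      using vector_derivative_diff_chain_within [of w c s UNIV p q]
      by (simp add: o_def has_derivative_at_withinI)
    have pw: "p (w s) = x"
      using pf x by metis
    have "((\<lambda>s. h (p (w s))) has_vector_derivative a * q c) (at s)"
         "((\<lambda>s. g (p (w s))) has_vector_derivative b * q c) (at s)"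
      using field_vector_diff_chain_at [OF dp, of h a] field_vector_diff_chain_at [OF dp, of g b]
        dh dg pw by (simp_all add: o_def mult.commute)
    then have "((\<lambda>s. (h (p (w s)) - cnj (g (p (w s)))) * cnj c) has_vector_derivative
        (a * q c - cnj (b * q c)) * cnj c) (at s)"
      by (intro has_vector_derivative_mult_left has_vector_derivative_diff has_vector_derivative_cnj)
    then have "(\<phi> has_real_derivative Re ((a * q c - cnj (b * q c)) * cnj c)) (at s)"
      unfolding \<phi>_def has_real_derivative_iff_has_vector_derivative
      by (rule bounded_linear.has_vector_derivative [OF bounded_linear_Re])
    \<comment> \<open>As \<open>a * q c + cnj (b * q c) = c\<close>, this real part equals
      \<open>(norm a ^ 2 - norm b ^ 2) * norm (q c) ^ 2\<close>.\<close>
    moreover have "0 < Re ((a * q c - cnj (b * q c)) * cnj c)"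
    proof -
      have "q c \<noteq> 0"
        using inv [of c] c by auto
      then have "(norm (b * q c))\<^sup>2 < (norm (a * q c))\<^sup>2"
        using ba by (intro power_strict_mono) (auto simp: norm_mult)
      then show ?thesis
        using norm_diff_eq_Re [OF inv [of c]] by linarith
    qed
    ultimately show ?thesis
      by blast
  qed
  then have "\<phi> 0 < \<phi> 1"
    by (rule DERIV_pos_imp_increasing [OF zero_less_one])
  then have "0 < Re ((h z2 - h z1 - cnj (g z2 - g z1)) * cnj c)"
    by (simp add: \<phi>_def w_def pf z c_def algebra_simps)
  moreover have "h z2 - h z1 + cnj (g z2 - g z1) = c"
    by (simp add: c_def f z)
  ultimately have "(norm (g z2 - g z1))\<^sup>2 < (norm (h z2 - h z1))\<^sup>2"
    using norm_diff_eq_Re [of "h z2 - h z1" "g z2 - g z1" c] by linarith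
  then show ?thesis
    by (simp add: power_less_imp_less_base)
qed

lemma norm_diff_le_mult_if_less:
  fixes h g :: "complex \<Rightarrow> complex"
  assumes h: "h holomorphic_on ball 0 1" and g: "g holomorphic_on ball 0 1"
    and less: "\<And>z1 z2. \<lbrakk>z1 \<in> ball 0 1; z2 \<in> ball 0 1; z1 \<noteq> z2\<rbrakk>
      \<Longrightarrow> norm (g z2 - g z1) < norm (h z2 - h z1)"
    and h0: "deriv h 0 \<noteq> 0" and g0: "deriv g 0 = 0"
    and r: "0 < r" "r < 1" and z: "z1 \<in> ball 0 r" "z2 \<in> ball 0 r"
  shows "norm (g z2 - g z1) \<le> r * norm (h z2 - h z1)"
proof (cases "z1 = z2")
  case False
  \<comment> \<open>Rescaling makes \<open>t = r\<close> the parameter that recovers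
    \<open>z1\<close> and \<open>z2\<close>, while \<open>t\<close> ranges over the whole unit disk;
    Schwarz' lemma at \<open>t = r\<close> then yields the factor \<open>r\<close>.\<close>
  define u v where "u = z1 / of_real r" and "v = z2 / of_real r"
  have uv: "norm u < 1" "norm v < 1" "u \<noteq> v"
    using z r False by (auto simp: u_def v_def norm_divide)
  define D where "D = (\<lambda>k t. k (t * v) - k (t * u) :: complex)"
  \<comment> \<open>The value 0 at the origin is the limit of the quotient there,
    \<open>deriv g 0 / deriv h 0\<close>, so the singularity is removable.\<close>
  define \<omega> where "\<omega> = (\<lambda>t. if t = 0 then 0 else D g t / D h t)"
  have in_ball: "t * u \<in> ball 0 1" "t * v \<in> ball 0 1" if "t \<in> ball 0 1" for t
    using that uv mult_strict_mono [of "norm t" 1 "norm u" 1]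
      mult_strict_mono [of "norm t" 1 "norm v" 1] by (auto simp: norm_mult)
  \<comment> \<open>The strict inequality serves twice: the denominator of \<omega> has no zero off
    the origin, and \<omega> maps into the open unit disk.\<close>
  have D_less: "norm (D g t) < norm (D h t)" if "t \<in> ball 0 1" "t \<noteq> 0" for t
    unfolding D_def using that in_ball uv by (intro less) auto
  have D_hol: "D k holomorphic_on ball 0 1" if "k holomorphic_on ball 0 1" for k
    unfolding D_def using in_ball
    by (intro holomorphic_intros holomorphic_on_compose_gen [OF _ that, unfolded o_def]) auto
  have \<omega>_hol': "\<omega> holomorphic_on ball 0 1 - {0}"
  proof -
    have "(\<lambda>t. D g t / D h t) holomorphic_on ball 0 1 - {0}"
      using D_less
      by (intro holomorphic_on_divide holomorphic_on_subset [OF D_hol] g h) force+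
    then show ?thesis
      by (rule holomorphic_transform) (simp add: \<omega>_def)
  qed
  have D_lim: "(\<lambda>t. D k t / t) \<midarrow>0\<rightarrow> deriv k 0 * (v - u)" if "k holomorphic_on ball 0 1" for k
  proof -
    have *: "((\<lambda>t. k (t * a)) has_field_derivative deriv k 0 * a) (at 0)" for a
    proof (rule DERIV_chain2 [where g = "\<lambda>t. t * a" and x = 0])
      show "(k has_field_derivative deriv k 0) (at (0 * a))"
        using that by (simp add: holomorphic_derivI)
      show "((\<lambda>t. t * a) has_field_derivative a) (at 0)"
        by (auto intro!: derivative_eq_intros)
    qed
    have "(D k has_field_derivative deriv k 0 * v - deriv k 0 * u) (at 0)"
      unfolding D_def
      by (intro DERIV_diff *)
    then show ?thesis
      by (simp add: has_field_derivative_iff D_def algebra_simps)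
  qed
  have "(\<lambda>t. (D g t / t) / (D h t / t)) \<midarrow>0\<rightarrow> deriv g 0 * (v - u) / (deriv h 0 * (v - u))"
    using h0 uv by (intro tendsto_divide D_lim g h) auto
  then have "(\<lambda>t. (D g t / t) / (D h t / t)) \<midarrow>0\<rightarrow> 0"
    by (simp add: g0)
  then have "\<omega> \<midarrow>0\<rightarrow> 0"
    by (rule Lim_transform_eventually) (auto simp: \<omega>_def eventually_at intro!: exI [of _ 1])
  then have "isCont \<omega> 0"
    by (simp add: isCont_def \<omega>_def)
  then have "continuous_on (ball 0 1) \<omega>"
    using \<omega>_hol' holomorphic_on_imp_continuous_on
    by (metis continuous_at_imp_continuous_on continuous_on_eq_continuous_at DiffI open_ball
        open_delete singletonD)
  then have \<omega>_hol: "\<omega> holomorphic_on ball 0 1"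
    using no_isolated_singularity [OF _ \<omega>_hol'] by simp
  have "norm (\<omega> t) < 1" if "norm t < 1" for t
    using D_less [of t] that by (auto simp: \<omega>_def norm_divide divide_less_eq)
  then have "norm (\<omega> r) \<le> norm (of_real r :: complex)"
    using Schwarz_Lemma(1) [OF \<omega>_hol, of "of_real r"] r by (simp add: \<omega>_def)
  then have "norm (D g r / D h r) \<le> r"
    using r by (simp add: \<omega>_def)
  moreover have "norm (D h r) > 0"
    using D_less [of r] r norm_ge_zero le_less_trans by fastforce
  ultimately show ?thesis
    using r by (simp add: D_def u_def v_def norm_divide divide_le_eq)
qed simp

theorem theorem7:
  fixes f h g :: "complex \<Rightarrow> complex" and r :: real and z1 z2 :: complex
  assumes "normalized_harmonic f h g"
    and "fully_convex f h g"
    and "0 < r" and "r < 1"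
    and "z1 \<in> ball 0 r" and "z2 \<in> ball 0 r"
  shows "norm (f z2 - f z1) / (1 + r) \<le> norm (h z2 - h z1) \<and>
         norm (h z2 - h z1) \<le> norm (f z2 - f z1) / (1 - r)"
proof -
  have h: "h holomorphic_on ball 0 1" and g: "g holomorphic_on ball 0 1"
    and f: "\<And>z. z \<in> ball 0 1 \<Longrightarrow> f z = h z + cnj (g z)"
    and dil: "\<And>z. z \<in> ball 0 1 \<Longrightarrow> norm (deriv g z) < norm (deriv h z)"
    and g0: "deriv g 0 = 0"
    using assms(1) unfolding normalized_harmonic_def sense_preserving_def harmonic_mapping_def
    by auto
  have inj: "inj_on f (ball 0 1)"
    and conv: "\<And>\<rho>. \<lbrakk>0 < \<rho>; \<rho> < 1\<rbrakk> \<Longrightarrow> convex (inside (f ` sphere 0 \<rho>))"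
    using assms(2) unfolding fully_convex_def convex_curve_def by auto
  have "continuous_on (ball 0 1) (\<lambda>z. h z + cnj (g z))"
    by (intro continuous_intros holomorphic_on_imp_continuous_on h g)
  then have cont: "continuous_on (ball 0 1) f"
    using f by (simp cong: continuous_on_cong_simp)
  have less: "norm (g b - g a) < norm (h b - h a)"
    if ab: "a \<in> ball 0 1" "b \<in> ball 0 1" "a \<noteq> b" for a b
  proof (rule norm_diff_co_holomorphic_less [OF open_ball h g f inj dil ab])
    \<comment> \<open>Convexity is given for circles of radius less than 1 only, so the two points
      are first enclosed in a smaller disk.\<close>
    obtain \<rho> where \<rho>: "max (norm a) (norm b) < \<rho>" "\<rho> < 1"
      using ab dense [of "max (norm a) (norm b)" 1] by auto
    then have \<rho>0: "0 < \<rho>"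
      using norm_ge_zero [of a] by linarith
    have sub: "cball 0 \<rho> \<subseteq> (ball 0 1 :: complex set)"
      using \<rho> by auto
    have "convex (f ` ball 0 \<rho>)"
      using convex_image_ball_if_convex_inside [OF \<rho>0 continuous_on_subset [OF cont sub]
          inj_on_subset [OF inj sub] conv [OF \<rho>0 \<rho>(2)]] .
    then have "closed_segment (f a) (f b) \<subseteq> f ` ball 0 \<rho>"
      using \<rho> by (intro closed_segment_subset) auto
    also have "\<dots> \<subseteq> f ` ball 0 1"
      using \<rho> by (intro image_mono) auto
    finally show "closed_segment (f a) (f b) \<subseteq> f ` ball 0 1" .
  qed auto
  have "deriv h 0 \<noteq> 0"
    using dil [of 0] by auto
  with less have gh: "norm (g z2 - g z1) \<le> r * norm (h z2 - h z1)"
    using g0 assms(3-6) by (intro norm_diff_le_mult_if_less [OF h g]) auto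
  have "f z2 - f z1 = (h z2 - h z1) + cnj (g z2 - g z1)"
    using assms(4-6) by (simp add: f)
  \<comment> \<open>With \<open>gh\<close>, the two triangle inequalities bound
    \<open>norm (f z2 - f z1)\<close> by \<open>1 + r\<close> times
    \<open>norm (h z2 - h z1)\<close> from above and by \<open>1 - r\<close> times it from
    below.\<close>
  then have "norm (f z2 - f z1) \<le> norm (h z2 - h z1) + norm (g z2 - g z1)"
    and "norm (h z2 - h z1) - norm (g z2 - g z1) \<le> norm (f z2 - f z1)"
    by (metis norm_triangle_ineq complex_mod_cnj, metis norm_diff_ineq complex_mod_cnj)
  with gh show ?thesis
    using assms(3,4) by (simp add: field_simps)
qed

end
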